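(* There is an absolute constant $c>0$ such that for every $n$-element set $\mathcal{A}$ of real numbers and every graph $G_n$ with vertex set $\mathcal{A}$ and $m$ edges, $$|\mathcal{A}+_{G_n}\mathcal{A}|+|\mathcal{A}\cdot_{G_n}\mathcal{A}|\ge c\,\frac{m^{3/2}}{n^{7/4}}.$$
   Context: For a graph $G$ whose vertices are the elements of a set $\mathcal{A}$ of reals, $\mathcal{A}+_{G}\mathcal{A}=\{a+b:\{a,b\}\in E(G)\}$ and $\mathcal{A}\cdot_{G}\mathcal{A}=\{ab:\{a,b\}\in E(G)\}$. *)

theory Defs
  imports "HOL-Analysis.Analysis"
begin

definition simple_graph :: "'a set \<Rightarrow> 'a set set \<Rightarrow> bool" where
  "simple_graph V E \<longleftrightarrow> (\<forall>e\<in>E. e \<subseteq> V \<and> card e = 2)"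

definition graph_sumset :: "real set set \<Rightarrow> real set" where
  "graph_sumset E = {a + b | a b. {a, b} \<in> E}"

definition graph_prodset :: "real set set \<Rightarrow> real set" where
  "graph_prodset E = {a * b | a b. {a, b} \<in> E}"

end

theory Submission
  imports Defs
begin

text \<open>
  Let S and P be the sum set and the product set along G, and N = |S| + |P|. As in Elekes'
  argument, every path a - b - c in G puts the point (a + b, b c) of the grid S \<times> P on the line
  y = c (x - a), so the at most n^2 lines have at least m^2 / n incidences with the grid.

  For a grid the Szemeredi--Trotter bound is elementary. Cut S and P into blocks of K consecutive
  elements. A line is the graph of a monotone function, so it meets at most 2 N / K + 1 of the
  resulting cells, and two points determine the line through them, so at most N^2 K^2 pairs of
  distinct points on a common line lie in a common cell. Hence there are at most
  n^2 (2 N / K + 1) + N^2 K^2 incidences, and K = (n^2 / N)^(1/3) gives the theorem. When m < 2 n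
  it already suffices that an edge is determined by its sum and product, so that m \<le> N^2.
\<close>

section \<open>Blocks of consecutive elements, and the cells met by a monotone curve\<close>

text \<open>The block index is the rank in \<open>X\<close> divided by \<open>K\<close>. Ranks make
  sense at every point of the type, so the index is monotone everywhere and can be composed with
  translations and scalings.\<close>

lemma block_partition:
  fixes X :: "'a::linorder set"
  assumes "finite X" "card X \<le> N" "K > 0"
  obtains f :: "'a \<Rightarrow> nat"
  where "mono f" "\<And>x. f x \<le> N div K" "\<And>i. card {x\<in>X. f x = i} \<le> K"
proof
  define r where "r x = card {y\<in>X. y < x}" for x
  have r_mono: "r x \<le> r y" if "x \<le> y" for x y
    unfolding r_def using that assms(1) by (intro card_mono) auto
  show "mono (\<lambda>x. r x div K)"
    using r_mono by (auto intro!: monoI div_le_mono)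
  have "r x \<le> N" for x
    unfolding r_def using assms(1,2) card_mono[of X "{y\<in>X. y < x}"] by auto
  then show "r x div K \<le> N div K" for x
    by (rule div_le_mono)
  have r_strict: "r x < r y" if "x \<in> X" "x < y" for x y
    unfolding r_def using that assms(1) by (intro psubset_card_mono) auto
  have r_inj: "inj_on r X"
    by (rule linorder_inj_onI) (use r_strict in \<open>force+\<close>)
  show "card {x\<in>X. r x div K = i} \<le> K" for i
  proof -
    have "r ` {x\<in>X. r x div K = i} \<subseteq> {i * K..<i * K + K}"
      using assms(3) by (auto simp: dividend_less_div_times add.commute)
    moreover have "inj_on r {x\<in>X. r x div K = i}"
      using r_inj by (rule inj_on_subset) auto
    ultimately have "card {x\<in>X. r x div K = i} \<le> card {i * K..<i * K + K}"
      by (intro card_inj_on_le) auto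
    then show ?thesis by simp
  qed
qed

text \<open>Along a nondecreasing family of index pairs, the sum of the two indices separates
  distinct pairs, and it ranges over 0, ..., \<open>2 * M\<close>.\<close>

lemma card_monotone_cells:
  fixes u v :: "'a::linorder \<Rightarrow> nat"
  assumes "mono u" "mono v" "\<And>b. u b \<le> M" "\<And>b. v b \<le> M"
  shows "card ((\<lambda>b. (u b, v b)) ` B) \<le> 2 * M + 1"
proof -
  have "inj_on (\<lambda>(i, j). i + j) ((\<lambda>b. (u b, v b)) ` B)"
  proof (rule inj_onI, clarsimp)
    fix b b' assume eq: "u b + v b = u b' + v b'"
    show "u b = u b' \<and> v b = v b'"
      using eq monoD[OF assms(1)] monoD[OF assms(2)]
      by (metis le_antisym
          linear nat_add_left_cancel_le add_le_cancel_right)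
  qed
  moreover have "(\<lambda>(i, j). i + j) ` ((\<lambda>b. (u b, v b)) ` B) \<subseteq> {..2 * M}"
    using add_mono[OF assms(3,4)] by (auto simp: mult_2)
  ultimately have "card ((\<lambda>b. (u b, v b)) ` B) \<le> card {..2 * M}"
    by (intro card_inj_on_le) auto
  then show ?thesis by simp
qed

text \<open>Reflecting the second index, \<open>j\<close> to \<open>M - j\<close>, reduces to the
  nondecreasing case; the truncated subtraction loses nothing because \<open>v b\<close> is at most
  \<open>M\<close>.\<close>

lemma card_antitone_cells:
  fixes u v :: "'a::linorder \<Rightarrow> nat"
  assumes "mono u" "antimono v" "\<And>b. u b \<le> M" "\<And>b. v b \<le> M"
  shows "card ((\<lambda>b. (u b, v b)) ` B) \<le> 2 * M + 1"
proof -
  have "(\<lambda>b. (u b, v b)) ` B = (\<lambda>(i, j). (i, M - j)) ` (\<lambda>b. (u b, M - v b)) ` B"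
    using assms(4) by (force simp: image_image)
  moreover have "inj_on (\<lambda>(i, j). (i, M - j)) ((\<lambda>b. (u b, M - v b)) ` B)"
    by (auto simp: inj_on_def)
  ultimately have "card ((\<lambda>b. (u b, v b)) ` B) = card ((\<lambda>b. (u b, M - v b)) ` B)"
    by (simp add: card_image)
  also have "\<dots> \<le> 2 * M + 1"
    using assms by (intro card_monotone_cells) (auto simp: monotone_def intro: diff_le_mono2)
  finally show ?thesis .
qed

section \<open>Counting by classes and by Cauchy-Schwarz\<close>

text \<open>Pick a representative of each class of \<open>h\<close>; every other element forms a
  colliding pair with its representative. For points on a line, with cells as classes, all but one
  point per cell are charged to pairs inside a cell.\<close>

lemma card_le_classes_plus_collisions:
  assumes "finite B"
  shows "card B \<le> card (h ` B) + card {(b, b') \<in> B \<times> B. b \<noteq> b' \<and> h b = h b'}"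
proof -
  define s where "s = (\<lambda>b. inv_into B h (h b))"
  have s: "s b \<in> B" "h (s b) = h b" if "b \<in> B" for b
    using that unfolding s_def by (auto intro: inv_into_into f_inv_into_f)
  have "card (s ` B) \<le> card (h ` B)"
    unfolding s_def image_image[symmetric, of "inv_into B h" h]
    using assms by (intro card_image_le) auto
  moreover have "card {b\<in>B. s b \<noteq> b} \<le> card {(b, b') \<in> B \<times> B. b \<noteq> b' \<and> h b = h b'}"
  proof (rule card_inj_on_le)
    show "inj_on (\<lambda>b. (b, s b)) {b\<in>B. s b \<noteq> b}" by (auto simp: inj_on_def)
    show "(\<lambda>b. (b, s b)) ` {b\<in>B. s b \<noteq> b} \<subseteq> {(b, b') \<in> B \<times> B. b \<noteq> b' \<and> h b = h b'}"
      using s by force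
    show "finite {(b, b') \<in> B \<times> B. b \<noteq> b' \<and> h b = h b'}"
      by (rule finite_subset[of _ "B \<times> B"]) (use assms in auto)
  qed
  moreover have "card B \<le> card (s ` B \<union> {b\<in>B. s b \<noteq> b})"
    using assms by (intro card_mono) force+
  moreover have "card (s ` B \<union> {b\<in>B. s b \<noteq> b}) \<le> card (s ` B) + card {b\<in>B. s b \<noteq> b}"
    by (rule card_Un_le)
  ultimately show ?thesis by linarith
qed

text \<open>Cauchy-Schwarz over the middle vertex \<open>b\<close>: the triples, including those
  with \<open>a = c\<close>, are counted by the sum of the squares of the sizes of the fibres
  \<open>D b\<close>.\<close>

lemma card_relation_square_le:
  assumes "finite A" "R \<subseteq> A \<times> A"
  shows "(card R)\<^sup>2 \<le> card A * card {(a, c, b). (a, b) \<in> R \<and> (c, b) \<in> R}"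
proof -
  define D where "D b = {a. (a, b) \<in> R}" for b
  have fD: "finite (D b)" for b
    by (rule finite_subset[OF _ assms(1)]) (use assms(2) D_def in auto)
  have "R = prod.swap ` (SIGMA b:A. D b)"
    using assms(2) by (force simp: D_def)
  then have "card R = card (SIGMA b:A. D b)"
    by (simp add: card_image)
  then have R: "card R = (\<Sum>b\<in>A. card (D b))"
    using assms(1) fD by simp
  have "{(a, c, b). (a, b) \<in> R \<and> (c, b) \<in> R} = (\<lambda>(b, a, c). (a, c, b)) ` (SIGMA b:A. D b \<times> D b)"
    using assms(2) by (force simp: D_def)
  moreover have "inj_on (\<lambda>(b, a, c). (a, c, b)) (SIGMA b:A. D b \<times> D b)"
    by (auto simp: inj_on_def)
  ultimately have "card {(a, c, b). (a, b) \<in> R \<and> (c, b) \<in> R} = card (SIGMA b:A. D b \<times> D b)"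
    by (simp only: card_image)
  then have T: "card {(a, c, b). (a, b) \<in> R \<and> (c, b) \<in> R} = (\<Sum>b\<in>A. (card (D b))\<^sup>2)"
    using assms(1) fD by (simp add: card_cartesian_product power2_eq_square)
  have "real ((card R)\<^sup>2) \<le> real (card A * (\<Sum>b\<in>A. (card (D b))\<^sup>2))"
    using sum_squared_le_sum_of_squares[of "\<lambda>b. real (card (D b))" A]
    by (simp add: R mult.commute)
  then show ?thesis
    unfolding T of_nat_le_iff .
qed

lemma card_same_block_pairs_le:
  assumes "finite X" "\<And>i. card {x\<in>X. f x = i} \<le> K"
  shows "card {(x, x') \<in> X \<times> X. f x = f x'} \<le> card X * K"
proof -
  have "{(x, x') \<in> X \<times> X. f x = f x'} = (SIGMA x:X. {x'\<in>X. f x' = f x})"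
    by auto
  then have "card {(x, x') \<in> X \<times> X. f x = f x'} = (\<Sum>x\<in>X. card {x'\<in>X. f x' = f x})"
    using assms(1) by simp
  also have "\<dots> \<le> card X * K"
    using sum_bounded_above[of X "\<lambda>x. card {x'\<in>X. f x' = f x}" K] assms(2) by simp
  finally show ?thesis .
qed

section \<open>Incidences between the grid and the lines\<close>

text \<open>A triple is the incidence of the point \<open>(a + b, c * b)\<close> with the line of
  parameters \<open>(a, c)\<close>. The first summand counts cells met by lines, the second pairs of
  points in a common cell. Every slope \<open>c\<close> that occurs is nonzero, so two points of a
  line recover both parameters.\<close>

lemma grid_incidence_bound:
  fixes R :: "(real \<times> real) set"
  assumes A: "finite A" "R \<subseteq> A \<times> A" "\<And>a b. (a, b) \<in> R \<Longrightarrow> a \<noteq> 0"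
    and S: "finite S" "card S \<le> N" "\<And>a b. (a, b) \<in> R \<Longrightarrow> a + b \<in> S"
    and P: "finite P" "card P \<le> N" "\<And>a b. (a, b) \<in> R \<Longrightarrow> a * b \<in> P"
    and K: "K > 0"
  shows "card {(a, c, b). (a, b) \<in> R \<and> (c, b) \<in> R}
    \<le> (card A)\<^sup>2 * (2 * (N div K) + 1) + N\<^sup>2 * K\<^sup>2"
proof -
  obtain f :: "real \<Rightarrow> nat" where f: "mono f" "\<And>x. f x \<le> N div K"
    "\<And>i. card {x\<in>S. f x = i} \<le> K"
    using block_partition[OF S(1,2) K] by blast
  obtain g :: "real \<Rightarrow> nat" where g: "mono g" "\<And>x. g x \<le> N div K"
    "\<And>i. card {x\<in>P. g x = i} \<le> K"
    using block_partition[OF P(1,2) K] by blast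
  \<comment> \<open>For a line \<open>p\<close>, the set \<open>B p\<close> lists its incidences by
    the parameter \<open>b\<close>, \<open>h p\<close> gives the cell of a point, and
    \<open>C p\<close> holds the ordered pairs of distinct points sharing a cell.\<close>
  define B where "B = (\<lambda>(a, c). {b. (a, b) \<in> R \<and> (c, b) \<in> R})"
  define h where "h = (\<lambda>(a, c) b. (f (a + b), g (c * b)))"
  define C where "C p = {(b, b') \<in> B p \<times> B p. b \<noteq> b' \<and> h p b = h p b'}" for p
  have fB: "finite (B p)" for p
    by (rule finite_subset[OF _ A(1)]) (use A(2) in \<open>auto simp: B_def\<close>)
  have fC: "finite (C p)" for p
    by (rule finite_subset[of _ "B p \<times> B p"]) (use fB in \<open>auto simp: C_def\<close>)
  have cells: "card (h p ` B p) \<le> 2 * (N div K) + 1" for p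
  proof -
    obtain a c where p: "p = (a, c)" by fastforce
    have u: "mono (\<lambda>b. f (a + b))"
      using f(1) by (auto simp: mono_def)
    show ?thesis
    \<comment> \<open>The sign of the slope decides whether the second block index rises or falls
      with \<open>b\<close>.\<close>
    proof (cases "c \<ge> 0")
      case True
      then have "mono (\<lambda>b. g (c * b))"
        using g(1) by (auto simp: mono_def mult_left_mono)
      then show ?thesis
        unfolding p h_def prod.case using u f(2) g(2) by (intro card_monotone_cells)
    next
      case False
      then have "antimono (\<lambda>b. g (c * b))"
        using g(1) by (auto simp: monotone_def mult_left_mono_neg)
      then show ?thesis
        unfolding p h_def prod.case using u f(2) g(2) by (intro card_antitone_cells)
    qed
  qed
  have "{(a, c, b). (a, b) \<in> R \<and> (c, b) \<in> R} = (\<lambda>((a, c), b). (a, c, b)) ` (SIGMA p:A \<times> A. B p)"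
    using A(2) by (force simp: B_def)
  moreover have "inj_on (\<lambda>((a, c), b). (a, c, b)) (SIGMA p:A \<times> A. B p)"
    by (auto simp: inj_on_def)
  ultimately have "card {(a, c, b). (a, b) \<in> R \<and> (c, b) \<in> R} = card (SIGMA p:A \<times> A. B p)"
    by (simp only: card_image)
  also have "\<dots> = (\<Sum>p\<in>A \<times> A. card (B p))"
    using A(1) fB by simp
  also have "\<dots> \<le> (\<Sum>p\<in>A \<times> A. (2 * (N div K) + 1) + card (C p))"
  proof (rule sum_mono)
    fix p
    show "card (B p) \<le> (2 * (N div K) + 1) + card (C p)"
      using card_le_classes_plus_collisions[OF fB, of p "h p"] cells[of p]
      unfolding C_def by linarith
  qed
  also have "\<dots> = (card A)\<^sup>2 * (2 * (N div K) + 1) + card (SIGMA p:A \<times> A. C p)"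
    unfolding sum.distrib
    using A(1) fC by (simp add: card_cartesian_product power2_eq_square)
  also have "card (SIGMA p:A \<times> A. C p) \<le> N\<^sup>2 * K\<^sup>2"
  proof -
    let ?X = "{(x, x') \<in> S \<times> S. f x = f x'}" and ?Y = "{(y, y') \<in> P \<times> P. g y = g y'}"
    \<comment> \<open>Two points on a line are recorded by their pair of x-coordinates and their
      pair of y-coordinates, each of which stays within one block.\<close>
    let ?\<phi> = "\<lambda>((a, c), (b, b')). ((a + b, a + b'), (c * b, c * b')) :: (real \<times> real) \<times> (real \<times> real)"
    have fXY: "finite ?X" "finite ?Y"
      by (rule finite_subset[of _ "S \<times> S"], use S in auto)
        (rule finite_subset[of _ "P \<times> P"], use P in auto)
    have "card (SIGMA p:A \<times> A. C p) \<le> card (?X \<times> ?Y)"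
    proof (rule card_inj_on_le)
      show "inj_on ?\<phi> (SIGMA p:A \<times> A. C p)"
      proof (rule inj_onI, clarsimp)
        fix a c b b' a2 c2 b2 b2' :: real
        assume C1: "(b, b') \<in> C (a, c)" and C2: "(b2, b2') \<in> C (a2, c2)"
          and e: "a + b = a2 + b2" "a + b' = a2 + b2'" "c * b = c2 * b2" "c * b' = c2 * b2'"
        have nz: "c \<noteq> 0" "b \<noteq> b'"
          using C1 A(3) by (auto simp: C_def B_def)
        \<comment> \<open>The x-differences equal the differences of the parameters, so comparing
          them with the y-differences gives the slope \<open>c\<close>; then \<open>c * b\<close>
          gives \<open>b\<close>, and \<open>a + b\<close> gives \<open>a\<close>.\<close>
        have d: "b - b' = b2 - b2'" using e by linarith
        have "c * (b - b') = c2 * (b2 - b2')" using e by (simp add: algebra_simps)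
        then have "c = c2" using d nz by simp
        then show "a = a2 \<and> c = c2 \<and> b = b2 \<and> b' = b2'"
          using e nz by simp
      qed
      show "?\<phi> ` (SIGMA p:A \<times> A. C p) \<subseteq> ?X \<times> ?Y"
        using S(3) P(3) by (auto simp: C_def B_def h_def)
      show "finite (?X \<times> ?Y)" using fXY by simp
    qed
    also have "\<dots> = card ?X * card ?Y"
      by (rule card_cartesian_product)
    also have "\<dots> \<le> (card S * K) * (card P * K)"
      by (intro mult_le_mono card_same_block_pairs_le S(1) P(1) f(3) g(3))
    also have "\<dots> \<le> (N * K) * (N * K)"
      using S(2) P(2) by (intro mult_le_mono) auto
    finally show ?thesis by (simp add: power2_eq_square ac_simps)
  qed
  finally show ?thesis by simp
qed

section \<open>Edges, sums and products\<close>

lemma graph_edgeE: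
  assumes "simple_graph A E" "e \<in> E"
  obtains a b where "e = {a, b}" "a \<noteq> b" "a \<in> A" "b \<in> A"
  using assms unfolding simple_graph_def by (metis card_2_iff insert_subset)

lemma finite_graph_sumset: "finite (graph_sumset E)"
  and finite_graph_prodset: "finite (graph_prodset E)"
  if "simple_graph A E" "finite A"
proof -
  have "graph_sumset E \<subseteq> (\<lambda>(a, b). a + b) ` (A \<times> A)" "graph_prodset E \<subseteq> (\<lambda>(a, b). a * b) ` (A \<times> A)"
    using that(1) by (force simp: simple_graph_def graph_sumset_def graph_prodset_def)+
  then show "finite (graph_sumset E)" "finite (graph_prodset E)"
    using that(2) by (auto intro: finite_subset)
qed

text \<open>An edge with sum \<open>s\<close> and product \<open>p\<close> is the root set of the
  quadratic X^2 - s X + p, so the pair \<open>(s, p)\<close> determines it.\<close>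

lemma card_edges_le_sums_times_products:
  assumes "simple_graph A E" "finite A"
  shows "card E \<le> card (graph_sumset E) * card (graph_prodset E)"
proof -
  have pairs: "{a, b} = {c, d}" if "a + b = c + d" "a * b = c * d" for a b c d :: real
  proof -
    have "(a - c) * (a - d) = a * a - a * (c + d) + c * d"
      by (simp add: algebra_simps)
    also have "\<dots> = 0"
      unfolding that[symmetric] by (simp add: algebra_simps)
    finally have "a = c \<or> a = d" by simp
    with that(1) show ?thesis by auto
  qed
  \<comment> \<open>The comprehension is that root set, so each edge is the image of its own pair
    \<open>(s, p)\<close>.\<close>
  have "E \<subseteq> (\<lambda>(s, p). {a. \<exists>b. a + b = s \<and> a * b = p}) ` (graph_sumset E \<times> graph_prodset E)"
  proof
    fix e assume e: "e \<in> E"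
    then obtain a b where ab: "e = {a, b}"
      using graph_edgeE[OF assms(1)] by blast
    have "e = {x. \<exists>y. x + y = a + b \<and> x * y = a * b}"
    proof (intro set_eqI iffI)
      fix x assume "x \<in> e"
      then show "x \<in> {x. \<exists>y. x + y = a + b \<and> x * y = a * b}"
        unfolding ab by (auto intro: exI[of _ a] exI[of _ b])
    next
      fix x assume "x \<in> {x. \<exists>y. x + y = a + b \<and> x * y = a * b}"
      then obtain y where "x + y = a + b" "x * y = a * b" by blast
      then have "{x, y} = e" unfolding ab by (rule pairs)
      then show "x \<in> e" by blast
    qed
    moreover have "a + b \<in> graph_sumset E" "a * b \<in> graph_prodset E"
      using e unfolding ab graph_sumset_def graph_prodset_def by blast+
    ultimately show "e \<in> (\<lambda>(s, p). {a. \<exists>b. a + b = s \<and> a * b = p}) ` (graph_sumset E \<times> graph_prodset E)"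
      by (intro image_eqI[of _ _ "(a + b, a * b)"]) simp_all
  qed
  then have "card E \<le> card (graph_sumset E \<times> graph_prodset E)"
    using assms finite_graph_sumset finite_graph_prodset by (intro surj_card_le) auto
  then show ?thesis by (simp add: card_cartesian_product)
qed

text \<open>At most one edge per vertex contains 0, and every other edge yields an ordered pair of
  nonzero endpoints. This secures the nonzero slopes needed for counting incidences.\<close>

lemma card_nonzero_arcs_ge:
  fixes E :: "real set set"
  assumes "simple_graph A E" "finite A"
  shows "card E \<le> card {(a, b). {a, b} \<in> E \<and> a \<noteq> 0 \<and> b \<noteq> 0} + card A"
proof -
  let ?R = "{(a, b). {a, b} \<in> E \<and> a \<noteq> 0 \<and> b \<noteq> 0}"
  have fR: "finite ?R"
    by (rule finite_subset[of _ "A \<times> A"]) (use assms in \<open>auto simp: simple_graph_def\<close>)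
  have "E \<subseteq> (\<lambda>(a, b). {a, b}) ` ?R \<union> (\<lambda>a. {0, a}) ` A"
  proof
    fix e assume "e \<in> E"
    moreover from this obtain a b where "e = {a, b}" "a \<in> A" "b \<in> A"
      using graph_edgeE[OF assms(1)] by blast
    ultimately show "e \<in> (\<lambda>(a, b). {a, b}) ` ?R \<union> (\<lambda>a. {0, a}) ` A"
      by (cases "a = 0 \<or> b = 0") (auto simp: insert_commute)
  qed
  then have "card E \<le> card ((\<lambda>(a, b). {a, b}) ` ?R \<union> (\<lambda>a. {0, a}) ` A)"
    using fR assms(2) by (intro card_mono) auto
  also have "\<dots> \<le> card ((\<lambda>(a, b). {a, b}) ` ?R) + card ((\<lambda>a. {0, a}) ` A)"
    by (rule card_Un_le)
  also have "\<dots> \<le> card ?R + card A"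
    using fR assms(2) by (intro add_mono card_image_le) auto
  finally show ?thesis .
qed

section \<open>Choice of the block size and passage to real exponents\<close>

text \<open>The terms n^2 N / K and N^2 K^2 balance at K = (n^2 / N)^(1/3). Cubing the resulting
  bound on \<open>m\<^sup>2\<close> makes all exponents integral.\<close>

lemma optimize_block_size:
  fixes n m N :: nat
  assumes bound: "\<And>K. K > 0 \<Longrightarrow> m\<^sup>2 \<le> 4 * n * (n\<^sup>2 * (2 * (N div K) + 1) + N\<^sup>2 * K\<^sup>2)"
    and N: "0 < N" "N \<le> n\<^sup>2" "n \<le> N\<^sup>2"
  shows "real m ^ 6 \<le> 28 ^ 3 * real n ^ 7 * real N ^ 4"
proof -
  have n: "n > 0" using N by (cases n) auto
  define s t where "s = root 3 (real n)" and "t = root 3 (real N)"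
  have st: "s > 0" "t > 0" and s3: "real n = s ^ 3" and t3: "real N = t ^ 3"
    using n N(1) by (auto simp: s_def t_def)
  define x where "x = s\<^sup>2 / t"
  have "real N \<le> (real n)\<^sup>2" "real n \<le> (real N)\<^sup>2"
    using N(2,3) unfolding of_nat_power[symmetric] of_nat_le_iff .
  then have "t ^ 3 \<le> (s\<^sup>2) ^ 3" "s ^ 3 \<le> (t\<^sup>2) ^ 3"
    unfolding s3 t3 by (simp_all flip: power_mult)
  then have ts: "t \<le> s\<^sup>2" and st2: "s \<le> t\<^sup>2"
    using st by (simp_all only: power_mono_iff zero_less_numeral less_imp_le zero_le_power)
  \<comment> \<open>This is where \<open>N \<le> n\<^sup>2\<close> enters: since \<open>x\<close> is
    at least 1, rounding it up to \<open>K\<close> at most doubles it.\<close>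
  have x1: "x \<ge> 1" using ts st by (simp add: x_def)
  define K where "K = nat \<lceil>x\<rceil>"
  have K: "x \<le> real K" "real K \<le> 2 * x" "K > 0"
    using x1 unfolding K_def by linarith+
  have "real (N div K) \<le> real N / real K"
    by (rule of_nat_div_le_of_nat)
  also have "\<dots> \<le> real N / x"
    using K x1 by (intro divide_left_mono) auto
  also have "\<dots> = t ^ 4 / s\<^sup>2"
    using st by (simp add: x_def t3 power_numeral_reduce)
  finally have NK: "real (N div K) \<le> t ^ 4 / s\<^sup>2" .
  have "real K ^ 2 \<le> (2 * x) ^ 2"
    using K by (intro power_mono) auto
  also have "\<dots> = 4 * s ^ 4 / t\<^sup>2"
    by (simp add: x_def power_divide power_mult_distrib flip: power_mult)
  finally have K2: "real K ^ 2 \<le> 4 * s ^ 4 / t\<^sup>2" .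
  have "real (m\<^sup>2) \<le> real (4 * n * (n\<^sup>2 * (2 * (N div K) + 1) + N\<^sup>2 * K\<^sup>2))"
    using bound[OF K(3)] by (simp only: of_nat_le_iff)
  then have "real m ^ 2 \<le> 4 * s ^ 3 * ((s ^ 3)\<^sup>2 * (2 * real (N div K) + 1) + (t ^ 3)\<^sup>2 * real K ^ 2)"
    by (simp add: s3 t3 distrib_left)
  also have "\<dots> \<le> 4 * s ^ 3 * ((s ^ 3)\<^sup>2 * (2 * (t ^ 4 / s\<^sup>2) + 1) + (t ^ 3)\<^sup>2 * (4 * s ^ 4 / t\<^sup>2))"
    using NK K2 st by (intro mult_left_mono add_mono) auto
  also have "\<dots> = 4 * s ^ 3 * (6 * s ^ 4 * t ^ 4 + s ^ 4 * s ^ 2)"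
    using st by (simp add: field_simps power_numeral_reduce)
  \<comment> \<open>The extra cell per line contributes s^6, which \<open>n \<le> N\<^sup>2\<close>,
    in the form \<open>s \<le> t\<^sup>2\<close>, absorbs. The constant becomes 28 = 4 * (2 + 4 +
    1).\<close>
  also have "\<dots> \<le> 4 * s ^ 3 * (6 * s ^ 4 * t ^ 4 + s ^ 4 * (t\<^sup>2) ^ 2)"
    using st st2 by (intro mult_left_mono add_mono power_mono) auto
  also have "\<dots> = 28 * s ^ 7 * t ^ 4"
    by (simp add: algebra_simps power_numeral_reduce)
  finally have "(real m ^ 2) ^ 3 \<le> (28 * s ^ 7 * t ^ 4) ^ 3"
    by (intro power_mono) auto
  then show ?thesis
    by (simp add: s3 t3 power_mult_distrib flip: power_mult)
qed

text \<open>Both sides are compared after taking fourth powers; \<open>C \<ge> 1\<close> lets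
  \<open>C ^ 3\<close> grow to the perfect fourth power \<open>C ^ 4\<close>.\<close>

lemma powr_ratio_le:
  fixes m n N :: real
  assumes "m \<ge> 0" "n > 0" "N \<ge> 0" "C \<ge> 1" "m ^ 6 \<le> C ^ 3 * n ^ 7 * N ^ 4"
  shows "m powr (3/2) / n powr (7/4) \<le> C * N"
proof -
  have "(m powr (3/2)) ^ 4 = m ^ 6"
    using assms(1) by (cases "m = 0") (simp_all add: powr_power)
  moreover have "(C * N * n powr (7/4)) ^ 4 = C ^ 4 * N ^ 4 * n ^ 7"
    using assms(2) by (simp add: power_mult_distrib powr_power)
  moreover have "C ^ 3 * (n ^ 7 * N ^ 4) \<le> C ^ 4 * (n ^ 7 * N ^ 4)"
    using assms by (intro mult_right_mono power_increasing) auto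
  ultimately have "(m powr (3/2)) ^ 4 \<le> (C * N * n powr (7/4)) ^ 4"
    using assms(5) by (simp add: ac_simps)
  then have "m powr (3/2) \<le> C * N * n powr (7/4)"
    using assms by (subst (asm) power_mono_iff) auto
  then show ?thesis
    using assms(2) by (simp add: pos_divide_le_eq)
qed

section \<open>Assembling the bound\<close>

lemma sum_product_along_graph:
  assumes "simple_graph A E" "finite A" "A \<noteq> {}"
  defines "N \<equiv> card (graph_sumset E) + card (graph_prodset E)"
  shows "real (card E) ^ 6 \<le> 28 ^ 3 * real (card A) ^ 7 * real N ^ 4"
proof -
  let ?n = "card A" and ?m = "card E"
  have n: "?n > 0" using assms by (simp add: card_gt_0_iff)
  have "?m \<le> N * N"
    using card_edges_le_sums_times_products[OF assms(1,2)] 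
    by (rule order_trans) (auto simp: N_def intro: mult_le_mono)
  then have mN: "?m \<le> N\<^sup>2" by (simp add: power2_eq_square)
  \<comment> \<open>Few edges are handled by \<open>mN\<close>, and large \<open>N\<close> by the
    trivial bound m \<le> n^2. The last case supplies the range needed to choose \<open>K\<close>,
    with n \<le> N^2 following from 2 n \<le> m \<le> N^2.\<close>
  consider "?m < 2 * ?n" | "?n\<^sup>2 < N" | "2 * ?n \<le> ?m" "N \<le> ?n\<^sup>2" by linarith
  then show ?thesis
  proof cases
    case 1
    have "?m ^ 4 * ?m ^ 2 \<le> (2 * ?n) ^ 4 * (N\<^sup>2)\<^sup>2"
      using 1 mN by (intro mult_mono power_mono) auto
    also have "\<dots> = 16 * ?n ^ 4 * N ^ 4"
      by (simp add: power_mult_distrib flip: power_mult)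
    also have "\<dots> \<le> 28 ^ 3 * ?n ^ 7 * N ^ 4"
    proof (intro mult_le_mono order_refl)
      show "?n ^ 4 \<le> ?n ^ 7" using n by (intro power_increasing) auto
    qed simp
    finally have "real (?m ^ 6) \<le> real (28 ^ 3 * ?n ^ 7 * N ^ 4)"
      unfolding of_nat_le_iff by (simp flip: power_add)
    then show ?thesis by simp
  next
    case 2
    have "E \<subseteq> (\<lambda>(a, b). {a, b}) ` (A \<times> A)"
      using graph_edgeE[OF assms(1)] by (auto simp: image_iff) metis
    then have "?m \<le> card (A \<times> A)"
      using assms(2) by (intro surj_card_le) auto
    then have m: "?m \<le> ?n\<^sup>2" by (simp add: card_cartesian_product power2_eq_square)
    have "?m ^ 6 \<le> (?n\<^sup>2) ^ 6"
      using m by (intro power_mono) auto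
    also have "\<dots> = ?n ^ 4 * (?n\<^sup>2) ^ 4"
      by (simp flip: power_mult power_add)
    also have "\<dots> \<le> (28 ^ 3 * ?n ^ 7) * N ^ 4"
    proof (intro mult_le_mono power_mono)
      have "?n ^ 4 \<le> ?n ^ 7" using n by (intro power_increasing) auto
      then show "?n ^ 4 \<le> 28 ^ 3 * ?n ^ 7" by simp
    qed (use 2 in auto)
    finally have "real (?m ^ 6) \<le> real (28 ^ 3 * ?n ^ 7 * N ^ 4)"
      unfolding of_nat_le_iff .
    then show ?thesis by simp
  next
    case 3
    let ?R = "{(a, b). {a, b} \<in> E \<and> a \<noteq> 0 \<and> b \<noteq> 0}"
    let ?T = "{(a, c, b). (a, b) \<in> ?R \<and> (c, b) \<in> ?R}"
    have RA: "?R \<subseteq> A \<times> A" using assms(1) by (auto simp: simple_graph_def)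
    \<comment> \<open>At most n \<le> m / 2 edges contain 0.\<close>
    have "?m \<le> 2 * card ?R"
      using card_nonzero_arcs_ge[OF assms(1,2)] 3(1) by linarith
    then have "?m\<^sup>2 \<le> (2 * card ?R)\<^sup>2"
      by (intro power_mono) auto
    also have "\<dots> = 4 * (card ?R)\<^sup>2" by (simp add: power_mult_distrib)
    also have "\<dots> \<le> 4 * ?n * card ?T"
      using card_relation_square_le[OF assms(2) RA] by simp
    finally have mT: "?m\<^sup>2 \<le> 4 * ?n * card ?T" .
    show ?thesis
    proof (rule optimize_block_size)
      fix K :: nat assume K: "K > 0"
      have "card ?T \<le> ?n\<^sup>2 * (2 * (N div K) + 1) + N\<^sup>2 * K\<^sup>2"
        by (rule grid_incidence_bound[OF assms(2) RA, of "graph_sumset E" N "graph_prodset E"])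
          (use K finite_graph_sumset[OF assms(1,2)] finite_graph_prodset[OF assms(1,2)] in
            \<open>auto simp: N_def graph_sumset_def graph_prodset_def\<close>)
      then show "?m\<^sup>2 \<le> 4 * ?n * (?n\<^sup>2 * (2 * (N div K) + 1) + N\<^sup>2 * K\<^sup>2)"
        using mT by (meson le_trans mult_le_mono2)
    next
      show "?n \<le> N\<^sup>2" using 3(1) mN by linarith
      then show "0 < N" using n by (cases N) auto
    qed (rule 3)
  qed
qed

theorem theorem4p1:
  shows "\<exists>c::real. c > 0 \<and>
    (\<forall>(n::nat) (m::nat) (A::real set) (E::real set set).
       finite A \<longrightarrow> card A = n \<longrightarrow> simple_graph A E \<longrightarrow> card E = m \<longrightarrow>
       real (card (graph_sumset E)) + real (card (graph_prodset E))
         \<ge> c * (real m powr (3/2) / real n powr (7/4)))"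
proof (intro exI[of _ "1/28"] conjI allI impI)
  fix n m :: nat and A :: "real set" and E :: "real set set"
  assume A: "finite A" "card A = n" and G: "simple_graph A E" "card E = m"
  let ?N = "card (graph_sumset E) + card (graph_prodset E)"
  have "real m powr (3/2) / real n powr (7/4) \<le> 28 * real ?N"
  proof (cases "A = {}")
    case True
    \<comment> \<open>Here \<open>n\<close> is 0, so the denominator is 0 and the quotient is 0 by
      convention.\<close>
    then show ?thesis using A by simp
  next
    case False
    then show ?thesis
      using sum_product_along_graph[OF G(1) A(1) False] A G
      by (intro powr_ratio_le) (auto simp: card_gt_0_iff)
  qed
  then show "real (card (graph_sumset E)) + real (card (graph_prodset E))
      \<ge> 1/28 * (real m powr (3/2) / real n powr (7/4))"
    by simp
qed simp

end
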